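(* Let $G$ be a group and $\mathbf X$ a $G$-category with $G$-indexed coproducts. Then there is a canonical isomorphism between the category $Z^1(G,\mathbf X)$ of $1$-cocycles $G\to\mathbf X$ and the category $\mathbf X^{G(-)}$ of $G(-)$-algebras. For a $1$-cocycle $(X,\xi):G\to\mathbf X$ with $\xi=(\xi_g)_{g\in G}$, the corresponding $G(-)$-algebra is the pair $(X,\xi_* )$ with the same $X$ and with $\xi_*:G(X)=\coprod_{g\in G}g(X)\to X$ induced by all $\xi_g:g(X)\to X$ ($g\in G$).
   Context: A $G$-category is a category $\mathbf X$ equipped with functors $g(-):\mathbf X\to\mathbf X$ ($g\in G$) such that $1(-)=1_{\mathbf X}$ and $(hg)(-)=h(-)\,g(-)$ (strict equalities). A $1$-cocycle $(X,\xi):G\to\mathbf X$ is an object $X$ with a family $\xi=(\xi_g)_{g\in G}$ of morphisms $\xi_g:g(X)\to X$ satisfying $\xi_1=1_X$ and $\xi_{hg}=\xi_h\,h(\xi_g)$ for all $g,h\in G$. A morphism $f:(X,\xi)\to(X',\xi')$ is a morphism $f:X\to X'$ in $\mathbf X$ with $f\xi_g=\xi'_g\,g(f)$ for all $g$. This gives the category $Z^1(G,\mathbf X)$. $G(-)$ is the monad on $\mathbf X$ with underlying endofunctor $X\mapsto G(X)=\coprod_{g\in G}g(X)$, with unit $X=1(X)\to\coprod_{g\in G}g(X)$ the coproduct injection indexed by $1\in G$, and with multiplication $G(G(X))=\coprod_{h\in G}h\bigl(\coprod_{g\in G}g(X)\bigr)\cong\coprod_{(h,g)\in G\times G}(hg)(X)\to\coprod_{k\in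 G}k(X)$ (each $h(-)$, being an isomorphism of categories, preserves coproducts) sending the $(h,g)$-summand identically onto the $hg$-summand. $\mathbf X^{G(-)}$ is its Eilenberg–Moore category of algebras. *)

theory Defs
  imports "HOL-Algebra.Group"
begin

section \<open>Categories, functors, natural transformations\<close>

record ('o, 'm) cat =
  Obj :: "'o set"
  Arr :: "'m set"
  Dom :: "'m \<Rightarrow> 'o"
  Cod :: "'m \<Rightarrow> 'o"
  Id :: "'o \<Rightarrow> 'm"
  Comp :: "'m \<Rightarrow> 'm \<Rightarrow> 'm"  (infixl "\<cdot>\<index>" 70)

definition Hom :: "('o, 'm) cat \<Rightarrow> 'o \<Rightarrow> 'o \<Rightarrow> 'm set" where
  "Hom C a b = {f \<in> Arr C. Dom C f = a \<and> Cod C f = b}"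

text \<open>Composition is in applicative order: \<open>g \<cdot> f\<close> is \<open>g\<close> after \<open>f\<close>.\<close>

locale category =
  fixes C :: "('o, 'm) cat" (structure)
  assumes Dom_Obj: "f \<in> Arr C \<Longrightarrow> Dom C f \<in> Obj C"
    and Cod_Obj: "f \<in> Arr C \<Longrightarrow> Cod C f \<in> Obj C"
    and Id_Hom: "a \<in> Obj C \<Longrightarrow> Id C a \<in> Hom C a a"
    and Comp_Hom: "f \<in> Hom C a b \<Longrightarrow> g \<in> Hom C b c \<Longrightarrow> g \<cdot> f \<in> Hom C a c"
    and Comp_Id: "f \<in> Hom C a b \<Longrightarrow> f \<cdot> Id C a = f"
    and Id_Comp: "f \<in> Hom C a b \<Longrightarrow> Id C b \<cdot> f = f"
    and Comp_assoc: "f \<in> Hom C a b \<Longrightarrow> g \<in> Hom C b c \<Longrightarrow> h \<in> Hom C c d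
      \<Longrightarrow> (h \<cdot> g) \<cdot> f = h \<cdot> (g \<cdot> f)"

record ('o, 'm, 'p, 'n) fmap =
  omap :: "'o \<Rightarrow> 'p"
  amap :: "'m \<Rightarrow> 'n"

definition id_fmap :: "('o, 'm, 'o, 'm) fmap" where
  "id_fmap = \<lparr>omap = (\<lambda>a. a), amap = (\<lambda>f. f)\<rparr>"

definition comp_fmap ::
  "('p, 'n, 'q, 'k) fmap \<Rightarrow> ('o, 'm, 'p, 'n) fmap \<Rightarrow> ('o, 'm, 'q, 'k) fmap" where
  "comp_fmap F' F = \<lparr>omap = omap F' \<circ> omap F, amap = amap F' \<circ> amap F\<rparr>"

text \<open>Equality of functors with domain \<open>C\<close>: only the values on the objects and
  arrows of \<open>C\<close> matter.\<close>

definition eq_fmap ::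
  "('o, 'm) cat \<Rightarrow> ('o, 'm, 'p, 'n) fmap \<Rightarrow> ('o, 'm, 'p, 'n) fmap \<Rightarrow> bool" where
  "eq_fmap C F F' \<longleftrightarrow> (\<forall>a \<in> Obj C. omap F a = omap F' a) \<and> (\<forall>f \<in> Arr C. amap F f = amap F' f)"

locale cat_functor = dom: category C + cod: category D
  for C :: "('o, 'm) cat" and D :: "('p, 'n) cat" +
  fixes F :: "('o, 'm, 'p, 'n) fmap"
  assumes omap_Obj: "a \<in> Obj C \<Longrightarrow> omap F a \<in> Obj D"
    and amap_Hom: "f \<in> Hom C a b \<Longrightarrow> amap F f \<in> Hom D (omap F a) (omap F b)"
    and amap_Id: "a \<in> Obj C \<Longrightarrow> amap F (Id C a) = Id D (omap F a)"
    and amap_Comp: "f \<in> Hom C a b \<Longrightarrow> g \<in> Hom C b c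
      \<Longrightarrow> amap F (g \<cdot>\<^bsub>C\<^esub> f) = amap F g \<cdot>\<^bsub>D\<^esub> amap F f"

definition cat_isomorphism ::
  "('o, 'm) cat \<Rightarrow> ('p, 'n) cat \<Rightarrow> ('o, 'm, 'p, 'n) fmap \<Rightarrow> bool" where
  "cat_isomorphism C D F \<longleftrightarrow> cat_functor C D F \<and>
     (\<exists>F'. cat_functor D C F' \<and>
        eq_fmap C (comp_fmap F' F) id_fmap \<and> eq_fmap D (comp_fmap F F') id_fmap)"

locale nat_transf = F: cat_functor C D F + F': cat_functor C D F'
  for C :: "('o, 'm) cat" and D :: "('p, 'n) cat"
    and F :: "('o, 'm, 'p, 'n) fmap" and F' :: "('o, 'm, 'p, 'n) fmap" +
  fixes t :: "'o \<Rightarrow> 'n"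
  assumes component_Hom: "a \<in> Obj C \<Longrightarrow> t a \<in> Hom D (omap F a) (omap F' a)"
    and naturality: "f \<in> Hom C a b \<Longrightarrow> t b \<cdot>\<^bsub>D\<^esub> amap F f = amap F' f \<cdot>\<^bsub>D\<^esub> t a"

text \<open>The category of objects of \<open>C\<close> with extra structure: \<open>S\<close> is the set of pairs
  (underlying object, structure), and a morphism from \<open>a\<close> to \<open>b\<close> is a morphism \<open>f\<close> of \<open>C\<close>
  between the underlying objects with \<open>M a b f\<close>. An arrow is stored together with its
  source and target, because the same \<open>f\<close> may underlie several arrows.\<close>

definition structured_cat ::
  "('o, 'm) cat \<Rightarrow> ('o \<times> 's) set \<Rightarrow> ('o \<times> 's \<Rightarrow> 'o \<times> 's \<Rightarrow> 'm \<Rightarrow> bool)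
    \<Rightarrow> ('o \<times> 's, ('o \<times> 's) \<times> ('o \<times> 's) \<times> 'm) cat" where
  "structured_cat C S M =
    \<lparr>Obj = S,
     Arr = {(a, b, f). a \<in> S \<and> b \<in> S \<and> f \<in> Hom C (fst a) (fst b) \<and> M a b f},
     Dom = (\<lambda>(a, b, f). a),
     Cod = (\<lambda>(a, b, f). b),
     Id = (\<lambda>a. (a, a, Id C (fst a))),
     Comp = (\<lambda>(_, c, g) (a, _, f). (a, c, g \<cdot>\<^bsub>C\<^esub> f))\<rparr>"

section \<open>Coproducts\<close>

definition is_coproduct ::
  "('o, 'm) cat \<Rightarrow> 'i set \<Rightarrow> ('i \<Rightarrow> 'o) \<Rightarrow> 'o \<Rightarrow> ('i \<Rightarrow> 'm) \<Rightarrow> bool" where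
  "is_coproduct C I A P \<iota> \<longleftrightarrow>
     P \<in> Obj C \<and> (\<forall>i \<in> I. \<iota> i \<in> Hom C (A i) P) \<and>
     (\<forall>B \<in> Obj C. \<forall>f. (\<forall>i \<in> I. f i \<in> Hom C (A i) B) \<longrightarrow>
        (\<exists>!h. h \<in> Hom C P B \<and> (\<forall>i \<in> I. h \<cdot>\<^bsub>C\<^esub> \<iota> i = f i)))"

definition has_coproducts :: "('o, 'm) cat \<Rightarrow> 'i set \<Rightarrow> bool" where
  "has_coproducts C I \<longleftrightarrow>
     (\<forall>A. (\<forall>i \<in> I. A i \<in> Obj C) \<longrightarrow> (\<exists>P \<iota>. is_coproduct C I A P \<iota>))"

text \<open>The arrow \<open>P \<rightarrow> B\<close> induced by the family \<open>f\<close> on a coproduct \<open>P\<close> with injections \<open>\<iota>\<close>.\<close>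

definition copair ::
  "('o, 'm) cat \<Rightarrow> 'i set \<Rightarrow> 'o \<Rightarrow> ('i \<Rightarrow> 'm) \<Rightarrow> 'o \<Rightarrow> ('i \<Rightarrow> 'm) \<Rightarrow> 'm" where
  "copair C I P \<iota> B f = (THE h. h \<in> Hom C P B \<and> (\<forall>i \<in> I. h \<cdot>\<^bsub>C\<^esub> \<iota> i = f i))"

section \<open>Monads and their algebras\<close>

record ('o, 'm) monad_data =
  endo :: "('o, 'm, 'o, 'm) fmap"
  unit :: "'o \<Rightarrow> 'm"
  mult :: "'o \<Rightarrow> 'm"

locale cat_monad = category C
  for C :: "('o, 'm) cat" (structure) +
  fixes T :: "('o, 'm) monad_data"
  assumes unit_nat: "nat_transf C C id_fmap (endo T) (unit T)"
    and mult_nat: "nat_transf C C (comp_fmap (endo T) (endo T)) (endo T) (mult T)"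
    and mult_unit: "a \<in> Obj C \<Longrightarrow> mult T a \<cdot> unit T (omap (endo T) a) = Id C (omap (endo T) a)"
    and mult_endo_unit: "a \<in> Obj C \<Longrightarrow> mult T a \<cdot> amap (endo T) (unit T a) = Id C (omap (endo T) a)"
    and mult_assoc: "a \<in> Obj C \<Longrightarrow>
      mult T a \<cdot> amap (endo T) (mult T a) = mult T a \<cdot> mult T (omap (endo T) a)"

definition algebras :: "('o, 'm) cat \<Rightarrow> ('o, 'm) monad_data \<Rightarrow> ('o \<times> 'm) set" where
  "algebras C T = {(X, \<alpha>). X \<in> Obj C \<and> \<alpha> \<in> Hom C (omap (endo T) X) X \<and>
     \<alpha> \<cdot>\<^bsub>C\<^esub> unit T X = Id C X \<and>
     \<alpha> \<cdot>\<^bsub>C\<^esub> mult T X = \<alpha> \<cdot>\<^bsub>C\<^esub> amap (endo T) \<alpha>}"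

definition Eilenberg_Moore ::
  "('o, 'm) cat \<Rightarrow> ('o, 'm) monad_data \<Rightarrow> ('o \<times> 'm, ('o \<times> 'm) \<times> ('o \<times> 'm) \<times> 'm) cat" where
  "Eilenberg_Moore C T = structured_cat C (algebras C T)
     (\<lambda>(X, \<alpha>) (X', \<alpha>') f. f \<cdot>\<^bsub>C\<^esub> \<alpha> = \<alpha>' \<cdot>\<^bsub>C\<^esub> amap (endo T) f)"

section \<open>G-categories and 1-cocycles\<close>

locale G_category = group G + category C
  for G :: "('g, 'z) monoid_scheme" (structure) and C :: "('o, 'm) cat" +
  fixes act :: "'g \<Rightarrow> ('o, 'm, 'o, 'm) fmap"
  assumes act_functor: "g \<in> carrier G \<Longrightarrow> cat_functor C C (act g)"
    and act_one: "eq_fmap C (act \<one>) id_fmap"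
    and act_mult: "h \<in> carrier G \<Longrightarrow> g \<in> carrier G
      \<Longrightarrow> eq_fmap C (act (h \<otimes> g)) (comp_fmap (act h) (act g))"

text \<open>The families \<open>\<xi>\<close> are indexed by \<open>carrier G\<close>; taking them extensional
  makes equality of functions coincide with equality of families.\<close>

definition cocycles ::
  "('g, 'z) monoid_scheme \<Rightarrow> ('o, 'm) cat \<Rightarrow> ('g \<Rightarrow> ('o, 'm, 'o, 'm) fmap)
    \<Rightarrow> ('o \<times> ('g \<Rightarrow> 'm)) set" where
  "cocycles G C act = {(X, \<xi>). X \<in> Obj C \<and>
     \<xi> \<in> (\<Pi>\<^sub>E g \<in> carrier G. Hom C (omap (act g) X) X) \<and>
     \<xi> \<one>\<^bsub>G\<^esub> = Id C X \<and>
     (\<forall>g \<in> carrier G. \<forall>h \<in> carrier G. \<xi> (h \<otimes>\<^bsub>G\<^esub> g) = \<xi> h \<cdot>\<^bsub>C\<^esub> amap (act h) (\<xi> g))}"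

definition Z1 ::
  "('g, 'z) monoid_scheme \<Rightarrow> ('o, 'm) cat \<Rightarrow> ('g \<Rightarrow> ('o, 'm, 'o, 'm) fmap)
    \<Rightarrow> ('o \<times> ('g \<Rightarrow> 'm), ('o \<times> ('g \<Rightarrow> 'm)) \<times> ('o \<times> ('g \<Rightarrow> 'm)) \<times> 'm) cat" where
  "Z1 G C act = structured_cat C (cocycles G C act)
     (\<lambda>(X, \<xi>) (X', \<xi>') f. \<forall>g \<in> carrier G. f \<cdot>\<^bsub>C\<^esub> \<xi> g = \<xi>' g \<cdot>\<^bsub>C\<^esub> amap (act g) f)"

section \<open>The monad G(-)\<close>

text \<open>A choice, for every object \<open>X\<close>, of a coproduct \<open>P X\<close> of the family \<open>g(X)\<close>, \<open>g \<in> G\<close>,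
  with injections \<open>\<iota> X g\<close>; the monad \<open>G(-)\<close> is only determined up to this choice.\<close>

definition orbit_coproducts ::
  "('g, 'z) monoid_scheme \<Rightarrow> ('o, 'm) cat \<Rightarrow> ('g \<Rightarrow> ('o, 'm, 'o, 'm) fmap)
    \<Rightarrow> ('o \<Rightarrow> 'o) \<Rightarrow> ('o \<Rightarrow> 'g \<Rightarrow> 'm) \<Rightarrow> bool" where
  "orbit_coproducts G C act P \<iota> \<longleftrightarrow>
     (\<forall>X \<in> Obj C. is_coproduct C (carrier G) (\<lambda>g. omap (act g) X) (P X) (\<iota> X))"

text \<open>In the multiplication, \<open>P (P X)\<close> is viewed as a coproduct of the family \<open>(hg)(X)\<close>,
  \<open>(h, g) \<in> G \<times> G\<close>, with injections \<open>\<iota> (P X) h \<cdot> h(\<iota> X g)\<close>; see the lemma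
  \<open>double_coproduct\<close> below. Its \<open>(h, g)\<close>-summand is sent to the \<open>hg\<close>-summand of \<open>P X\<close>.\<close>

definition G_monad ::
  "('g, 'z) monoid_scheme \<Rightarrow> ('o, 'm) cat \<Rightarrow> ('g \<Rightarrow> ('o, 'm, 'o, 'm) fmap)
    \<Rightarrow> ('o \<Rightarrow> 'o) \<Rightarrow> ('o \<Rightarrow> 'g \<Rightarrow> 'm) \<Rightarrow> ('o, 'm) monad_data" where
  "G_monad G C act P \<iota> =
    \<lparr>endo = \<lparr>omap = P,
             amap = (\<lambda>f. copair C (carrier G) (P (Dom C f)) (\<iota> (Dom C f)) (P (Cod C f))
                      (\<lambda>g. \<iota> (Cod C f) g \<cdot>\<^bsub>C\<^esub> amap (act g) f))\<rparr>,
     unit = (\<lambda>X. \<iota> X \<one>\<^bsub>G\<^esub>),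
     mult = (\<lambda>X. copair C (carrier G \<times> carrier G) (P (P X))
              (\<lambda>(h, g). \<iota> (P X) h \<cdot>\<^bsub>C\<^esub> amap (act h) (\<iota> X g)) (P X)
              (\<lambda>(h, g). \<iota> X (h \<otimes>\<^bsub>G\<^esub> g)))\<rparr>"

text \<open>The comparison \<open>(X, \<xi>) \<mapsto> (X, \<xi>\<^sub>*)\<close>, which is the identity on underlying morphisms.\<close>

definition cocycle_to_algebra ::
  "('g, 'z) monoid_scheme \<Rightarrow> ('o, 'm) cat \<Rightarrow> ('o \<Rightarrow> 'o) \<Rightarrow> ('o \<Rightarrow> 'g \<Rightarrow> 'm)
    \<Rightarrow> 'o \<times> ('g \<Rightarrow> 'm) \<Rightarrow> 'o \<times> 'm" where
  "cocycle_to_algebra G C P \<iota> = (\<lambda>(X, \<xi>). (X, copair C (carrier G) (P X) (\<iota> X) X \<xi>))"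

definition comparison ::
  "('g, 'z) monoid_scheme \<Rightarrow> ('o, 'm) cat \<Rightarrow> ('o \<Rightarrow> 'o) \<Rightarrow> ('o \<Rightarrow> 'g \<Rightarrow> 'm)
    \<Rightarrow> ('o \<times> ('g \<Rightarrow> 'm), ('o \<times> ('g \<Rightarrow> 'm)) \<times> ('o \<times> ('g \<Rightarrow> 'm)) \<times> 'm,
        'o \<times> 'm, ('o \<times> 'm) \<times> ('o \<times> 'm) \<times> 'm) fmap" where
  "comparison G C P \<iota> =
    \<lparr>omap = cocycle_to_algebra G C P \<iota>,
     amap = (\<lambda>(a, b, f). (cocycle_to_algebra G C P \<iota> a, cocycle_to_algebra G C P \<iota> b, f))\<rparr>"

section \<open>Well-definedness of the monad\<close>

lemma orbit_coproducts_exist: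
  assumes "G_category G C act" and "has_coproducts C (carrier G)"
  shows "\<exists>P \<iota>. orbit_coproducts G C act P \<iota>"
proof -
  interpret G_category G C act by fact
  have "\<forall>X. \<exists>Q. X \<in> Obj C \<longrightarrow>
      is_coproduct C (carrier G) (\<lambda>g. omap (act g) X) (fst Q) (snd Q)"
  proof
    fix X
    show "\<exists>Q. X \<in> Obj C \<longrightarrow> is_coproduct C (carrier G) (\<lambda>g. omap (act g) X) (fst Q) (snd Q)"
    proof (cases "X \<in> Obj C")
      case True
      then have "\<forall>g \<in> carrier G. omap (act g) X \<in> Obj C"
        using act_functor cat_functor.omap_Obj by fast
      then obtain P \<iota> where "is_coproduct C (carrier G) (\<lambda>g. omap (act g) X) P \<iota>"
        using assms(2) unfolding has_coproducts_def by (elim allE[of _ "\<lambda>g. omap (act g) X"]) blast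
      then show ?thesis by (intro exI[of _ "(P, \<iota>)"]) simp
    qed simp
  qed
  then obtain Q where "\<forall>X. X \<in> Obj C \<longrightarrow>
      is_coproduct C (carrier G) (\<lambda>g. omap (act g) X) (fst (Q X)) (snd (Q X))"
    by (rule choice[THEN exE])
  then show ?thesis
    unfolding orbit_coproducts_def
    by (intro exI[of _ "\<lambda>X. fst (Q X)"] exI[of _ "\<lambda>X. snd (Q X)"]) simp
qed

lemma copair_props:
  assumes "is_coproduct C I A P \<iota>" and "B \<in> Obj C" and "\<And>i. i \<in> I \<Longrightarrow> f i \<in> Hom C (A i) B"
  shows copair_Hom: "copair C I P \<iota> B f \<in> Hom C P B"
    and copair_inj: "i \<in> I \<Longrightarrow> copair C I P \<iota> B f \<cdot>\<^bsub>C\<^esub> \<iota> i = f i"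
proof -
  have "\<exists>!h. h \<in> Hom C P B \<and> (\<forall>i \<in> I. h \<cdot>\<^bsub>C\<^esub> \<iota> i = f i)"
    using assms unfolding is_coproduct_def by blast
  from theI'[OF this] show "copair C I P \<iota> B f \<in> Hom C P B"
    and "i \<in> I \<Longrightarrow> copair C I P \<iota> B f \<cdot>\<^bsub>C\<^esub> \<iota> i = f i"
    unfolding copair_def by blast+
qed

lemma (in category) coproduct_eqI:
  assumes "is_coproduct C I A P \<iota>" and "h \<in> Hom C P B" and "h' \<in> Hom C P B"
    and "\<And>i. i \<in> I \<Longrightarrow> h \<cdot> \<iota> i = h' \<cdot> \<iota> i"
  shows "h = h'"
proof -
  have B: "B \<in> Obj C" using assms(2) Cod_Obj by (auto simp: Hom_def)
  have "\<forall>i \<in> I. h' \<cdot> \<iota> i \<in> Hom C (A i) B"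
    using assms(1,3) Comp_Hom unfolding is_coproduct_def by blast
  then have *: "\<exists>!k. k \<in> Hom C P B \<and> (\<forall>i \<in> I. k \<cdot> \<iota> i = h' \<cdot> \<iota> i)"
    by (rule assms(1)[unfolded is_coproduct_def, THEN conjunct2, THEN conjunct2, THEN bspec, OF B,
          THEN spec, THEN mp])
  have "(THE k. k \<in> Hom C P B \<and> (\<forall>i \<in> I. k \<cdot> \<iota> i = h' \<cdot> \<iota> i)) = h"
    by (rule the1_equality[OF *]) (intro conjI ballI assms(2,4))
  moreover have "(THE k. k \<in> Hom C P B \<and> (\<forall>i \<in> I. k \<cdot> \<iota> i = h' \<cdot> \<iota> i)) = h'"
    by (rule the1_equality[OF *]) (intro conjI ballI refl assms(3))
  ultimately show ?thesis by simp
qed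

lemma (in category) nested_coproduct:
  assumes R: "is_coproduct C I Q R \<kappa>"
    and Q: "\<And>i. i \<in> I \<Longrightarrow> is_coproduct C J (A i) (Q i) (l i)"
  shows "is_coproduct C (I \<times> J) (\<lambda>(i, j). A i j) R (\<lambda>(i, j). \<kappa> i \<cdot> l i j)"
proof -
  have \<kappa>: "\<kappa> i \<in> Hom C (Q i) R" if "i \<in> I" for i using R that by (simp add: is_coproduct_def)
  have l: "l i j \<in> Hom C (A i j) (Q i)" if "i \<in> I" "j \<in> J" for i j
    using Q[OF that(1)] that(2) by (simp add: is_coproduct_def)
  have "\<exists>!k. k \<in> Hom C R B \<and> (\<forall>p \<in> I \<times> J. k \<cdot> (case p of (i, j) \<Rightarrow> \<kappa> i \<cdot> l i j) = f p)"
    if B: "B \<in> Obj C" and f: "\<forall>p \<in> I \<times> J. f p \<in> Hom C (case p of (i, j) \<Rightarrow> A i j) B" for B f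
  proof -
    define m where "m i = copair C J (Q i) (l i) B (\<lambda>j. f (i, j))" for i
    have f': "f (i, j) \<in> Hom C (A i j) B" if "i \<in> I" "j \<in> J" for i j
      using f that by auto
    have m: "m i \<in> Hom C (Q i) B" if "i \<in> I" for i
      unfolding m_def using Q[OF that] B f'[OF that] by (rule copair_Hom)
    have mj: "m i \<cdot> l i j = f (i, j)" if "i \<in> I" "j \<in> J" for i j
      unfolding m_def using Q[OF that(1)] B f'[OF that(1)] that(2) by (rule copair_inj)
    define k where "k = copair C I R \<kappa> B m"
    have k: "k \<in> Hom C R B" unfolding k_def using R B m by (rule copair_Hom)
    have ki: "k \<cdot> \<kappa> i = m i" if "i \<in> I" for i
      unfolding k_def using R B m that by (rule copair_inj)
    show ?thesis
    proof (rule ex1I[of _ k])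
      show "k \<in> Hom C R B \<and> (\<forall>p \<in> I \<times> J. k \<cdot> (case p of (i, j) \<Rightarrow> \<kappa> i \<cdot> l i j) = f p)"
        using k by (auto simp: ki mj Comp_assoc[OF l \<kappa> k, symmetric])
    next
      fix k' assume k': "k' \<in> Hom C R B \<and> (\<forall>p \<in> I \<times> J. k' \<cdot> (case p of (i, j) \<Rightarrow> \<kappa> i \<cdot> l i j) = f p)"
      show "k' = k"
      proof (rule coproduct_eqI[OF R _ k])
        fix i assume i: "i \<in> I"
        have "k' \<cdot> \<kappa> i = m i"
        proof (rule coproduct_eqI[OF Q[OF i] _ m[OF i]])
          show "k' \<cdot> \<kappa> i \<in> Hom C (Q i) B" using Comp_Hom \<kappa>[OF i] k' by blast
          show "k' \<cdot> \<kappa> i \<cdot> l i j = m i \<cdot> l i j" if "j \<in> J" for j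
            using k' i that by (auto simp: mj Comp_assoc[OF l \<kappa> conjunct1[OF k']])
        qed
        then show "k' \<cdot> \<kappa> i = k \<cdot> \<kappa> i" using ki[OF i] by simp
      qed (use k' in simp)
    qed
  qed
  then show ?thesis
    using R Comp_Hom[OF l \<kappa>] unfolding is_coproduct_def[of C "I \<times> J"]
    by (auto simp: is_coproduct_def[of C I])
qed

context G_category
begin

lemma act_Obj [intro, simp]: "g \<in> carrier G \<Longrightarrow> X \<in> Obj C \<Longrightarrow> omap (act g) X \<in> Obj C"
  using act_functor cat_functor.omap_Obj by fast

lemma act_Hom [intro]:
  "g \<in> carrier G \<Longrightarrow> f \<in> Hom C a b \<Longrightarrow> amap (act g) f \<in> Hom C (omap (act g) a) (omap (act g) b)"
  using act_functor cat_functor.amap_Hom by fast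

lemma act_Comp:
  "g \<in> carrier G \<Longrightarrow> f \<in> Hom C a b \<Longrightarrow> k \<in> Hom C b c
    \<Longrightarrow> amap (act g) (k \<cdot>\<^bsub>C\<^esub> f) = amap (act g) k \<cdot>\<^bsub>C\<^esub> amap (act g) f"
  using act_functor cat_functor.amap_Comp by fast

lemma act_Id: "g \<in> carrier G \<Longrightarrow> a \<in> Obj C \<Longrightarrow> amap (act g) (Id C a) = Id C (omap (act g) a)"
  using act_functor cat_functor.amap_Id by fast

lemma act_one_simps [simp]:
  "X \<in> Obj C \<Longrightarrow> omap (act \<one>) X = X" "f \<in> Hom C a b \<Longrightarrow> amap (act \<one>) f = f"
  using act_one by (auto simp: eq_fmap_def id_fmap_def Hom_def)

lemma act_mult_obj:
  "\<lbrakk>h \<in> carrier G; g \<in> carrier G; X \<in> Obj C\<rbrakk>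
    \<Longrightarrow> omap (act (h \<otimes> g)) X = omap (act h) (omap (act g) X)"
  using act_mult by (auto simp: eq_fmap_def comp_fmap_def)

lemma act_mult_arr:
  "\<lbrakk>h \<in> carrier G; g \<in> carrier G; f \<in> Hom C a b\<rbrakk>
    \<Longrightarrow> amap (act (h \<otimes> g)) f = amap (act h) (amap (act g) f)"
  using act_mult by (auto simp: eq_fmap_def comp_fmap_def Hom_def)

lemma Hom_Obj: "f \<in> Hom C a b \<Longrightarrow> a \<in> Obj C \<and> b \<in> Obj C"
  using Dom_Obj Cod_Obj by (auto simp: Hom_def)

lemma act_inv_cancel:
  assumes "h \<in> carrier G"
  shows "X \<in> Obj C \<Longrightarrow> omap (act h) (omap (act (inv h)) X) = X"
    and "X \<in> Obj C \<Longrightarrow> omap (act (inv h)) (omap (act h) X) = X"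
    and "f \<in> Hom C a b \<Longrightarrow> amap (act h) (amap (act (inv h)) f) = f"
    and "f \<in> Hom C a b \<Longrightarrow> amap (act (inv h)) (amap (act h) f) = f"
  using assms act_mult_obj[of h "inv h" X] act_mult_obj[of "inv h" h X]
    act_mult_arr[of h "inv h" f a b] act_mult_arr[of "inv h" h f a b]
  by (auto simp: r_inv l_inv)

lemma act_preserves_coproduct:
  assumes h: "h \<in> carrier G" and cop: "is_coproduct C I A P \<iota>"
  shows "is_coproduct C I (\<lambda>i. omap (act h) (A i)) (omap (act h) P) (\<lambda>i. amap (act h) (\<iota> i))"
  unfolding is_coproduct_def
proof (intro conjI ballI allI impI)
  show "omap (act h) P \<in> Obj C" using h cop by (auto simp: is_coproduct_def)
  show "amap (act h) (\<iota> i) \<in> Hom C (omap (act h) (A i)) (omap (act h) P)" if "i \<in> I" for i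
    using h cop that by (auto simp: is_coproduct_def)
next
  fix B f
  assume B: "B \<in> Obj C" and f: "\<forall>i \<in> I. f i \<in> Hom C (omap (act h) (A i)) B"
  let ?B = "omap (act (inv h)) B"
  have hi: "inv h \<in> carrier G" using h by simp
  have A: "A i \<in> Obj C" and \<iota>: "\<iota> i \<in> Hom C (A i) P" if "i \<in> I" for i
    using cop that Hom_Obj unfolding is_coproduct_def by blast+
  have P: "P \<in> Obj C" using cop by (simp add: is_coproduct_def)
  have f': "amap (act (inv h)) (f i) \<in> Hom C (A i) ?B" if "i \<in> I" for i
    using act_Hom[OF hi f[rule_format, OF that]] act_inv_cancel(2)[OF h A[OF that]] by simp
  have B': "?B \<in> Obj C" using hi B by simp
  define k where "k = copair C I P \<iota> ?B (\<lambda>i. amap (act (inv h)) (f i))"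
  have k: "k \<in> Hom C P ?B"
    unfolding k_def using cop B' f' by (rule copair_Hom)
  have ki: "k \<cdot>\<^bsub>C\<^esub> \<iota> i = amap (act (inv h)) (f i)" if "i \<in> I" for i
    unfolding k_def using cop B' f' that by (rule copair_inj)
  show "\<exists>!k. k \<in> Hom C (omap (act h) P) B \<and> (\<forall>i \<in> I. k \<cdot>\<^bsub>C\<^esub> amap (act h) (\<iota> i) = f i)"
  proof (rule ex1I[of _ "amap (act h) k"], intro conjI ballI)
    show "amap (act h) k \<in> Hom C (omap (act h) P) B"
      using act_Hom[OF h k] act_inv_cancel(1)[OF h B] by simp
    show "amap (act h) k \<cdot>\<^bsub>C\<^esub> amap (act h) (\<iota> i) = f i" if "i \<in> I" for i
      using act_Comp[OF h \<iota>[OF that] k] ki[OF that] act_inv_cancel(3)[OF h f[rule_format, OF that]]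
      by simp
  next
    fix k' assume k': "k' \<in> Hom C (omap (act h) P) B \<and> (\<forall>i \<in> I. k' \<cdot>\<^bsub>C\<^esub> amap (act h) (\<iota> i) = f i)"
    have *: "amap (act (inv h)) k' \<in> Hom C P ?B"
      using act_Hom[OF hi conjunct1[OF k']] act_inv_cancel(2)[OF h P] by simp
    have "amap (act (inv h)) k' = k"
    proof (rule coproduct_eqI[OF cop * k])
      fix i assume i: "i \<in> I"
      have "amap (act (inv h)) (k' \<cdot>\<^bsub>C\<^esub> amap (act h) (\<iota> i)) =
          amap (act (inv h)) k' \<cdot>\<^bsub>C\<^esub> amap (act (inv h)) (amap (act h) (\<iota> i))"
        using act_Comp[OF hi act_Hom[OF h \<iota>[OF i]] conjunct1[OF k']] .
      then show "amap (act (inv h)) k' \<cdot>\<^bsub>C\<^esub> \<iota> i = k \<cdot>\<^bsub>C\<^esub> \<iota> i"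
        using k' i ki[OF i] act_inv_cancel(4)[OF h \<iota>[OF i]] by simp
    qed
    then show "k' = amap (act h) k"
      using act_inv_cancel(3)[OF h conjunct1[OF k']] by simp
  qed
qed

context
  fixes P \<iota>
  assumes orbit: "orbit_coproducts G C act P \<iota>"
begin

lemma orbit_coproduct:
  "X \<in> Obj C \<Longrightarrow> is_coproduct C (carrier G) (\<lambda>g. omap (act g) X) (P X) (\<iota> X)"
  using orbit by (simp add: orbit_coproducts_def)

lemma P_Obj: "X \<in> Obj C \<Longrightarrow> P X \<in> Obj C"
  using orbit_coproduct by (simp add: is_coproduct_def)

lemma inj_Hom: "X \<in> Obj C \<Longrightarrow> g \<in> carrier G \<Longrightarrow> \<iota> X g \<in> Hom C (omap (act g) X) (P X)"
  using orbit_coproduct by (simp add: is_coproduct_def)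

lemma double_coproduct:
  assumes X: "X \<in> Obj C"
  shows "is_coproduct C (carrier G \<times> carrier G) (\<lambda>(h, g). omap (act (h \<otimes> g)) X) (P (P X))
    (\<lambda>(h, g). \<iota> (P X) h \<cdot>\<^bsub>C\<^esub> amap (act h) (\<iota> X g))"
proof -
  have "is_coproduct C (carrier G \<times> carrier G) (\<lambda>(h, g). omap (act h) (omap (act g) X)) (P (P X))
      (\<lambda>(h, g). \<iota> (P X) h \<cdot>\<^bsub>C\<^esub> amap (act h) (\<iota> X g))"
    by (rule nested_coproduct[OF orbit_coproduct[OF P_Obj[OF X]]
          act_preserves_coproduct[OF _ orbit_coproduct[OF X]]])
  then show ?thesis
    using X by (simp add: is_coproduct_def act_mult_obj split_beta)
qed

abbreviation "T \<equiv> G_monad G C act P \<iota>"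

lemma endo_obj [simp]: "omap (endo T) X = P X"
  by (simp add: G_monad_def)

lemma unit_eq [simp]: "unit T X = \<iota> X \<one>"
  by (simp add: G_monad_def)

lemma endo_arr:
  assumes f: "f \<in> Hom C a b"
  shows "amap (endo T) f \<in> Hom C (P a) (P b)"
    and "g \<in> carrier G \<Longrightarrow> amap (endo T) f \<cdot>\<^bsub>C\<^esub> \<iota> a g = \<iota> b g \<cdot>\<^bsub>C\<^esub> amap (act g) f"
proof -
  have ab: "a \<in> Obj C" "b \<in> Obj C" using Hom_Obj[OF f] by auto
  have *: "amap (endo T) f = copair C (carrier G) (P a) (\<iota> a) (P b)
      (\<lambda>g. \<iota> b g \<cdot>\<^bsub>C\<^esub> amap (act g) f)"
    using f by (auto simp: G_monad_def Hom_def)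
  have **: "\<iota> b g \<cdot>\<^bsub>C\<^esub> amap (act g) f \<in> Hom C (omap (act g) a) (P b)" if "g \<in> carrier G" for g
    using Comp_Hom[OF act_Hom[OF that f] inj_Hom[OF ab(2) that]] .
  show "amap (endo T) f \<in> Hom C (P a) (P b)"
    unfolding * by (rule copair_Hom[OF orbit_coproduct[OF ab(1)] P_Obj[OF ab(2)] **])
  show "amap (endo T) f \<cdot>\<^bsub>C\<^esub> \<iota> a g = \<iota> b g \<cdot>\<^bsub>C\<^esub> amap (act g) f" if "g \<in> carrier G"
    unfolding * by (rule copair_inj[OF orbit_coproduct[OF ab(1)] P_Obj[OF ab(2)] ** that])
qed

lemma mult_arr:
  assumes X: "X \<in> Obj C"
  shows "mult T X \<in> Hom C (P (P X)) (P X)"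
    and "h \<in> carrier G \<Longrightarrow> g \<in> carrier G \<Longrightarrow>
      mult T X \<cdot>\<^bsub>C\<^esub> (\<iota> (P X) h \<cdot>\<^bsub>C\<^esub> amap (act h) (\<iota> X g)) = \<iota> X (h \<otimes> g)"
proof -
  have *: "(case p of (h, g) \<Rightarrow> \<iota> X (h \<otimes> g)) \<in>
      Hom C (case p of (h, g) \<Rightarrow> omap (act (h \<otimes> g)) X) (P X)"
    if "p \<in> carrier G \<times> carrier G" for p
    using inj_Hom[OF X] that by auto
  show "mult T X \<in> Hom C (P (P X)) (P X)"
    using copair_Hom[OF double_coproduct[OF X] P_Obj[OF X] *]
    by (simp add: G_monad_def)
  show "mult T X \<cdot>\<^bsub>C\<^esub> (\<iota> (P X) h \<cdot>\<^bsub>C\<^esub> amap (act h) (\<iota> X g)) = \<iota> X (h \<otimes> g)"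
    if "h \<in> carrier G" "g \<in> carrier G"
    using copair_inj[OF double_coproduct[OF X] P_Obj[OF X] *, of "(h, g)"] that
    by (simp add: G_monad_def)
qed

lemma endo_functor: "cat_functor C C (endo T)"
proof
  fix a assume a: "a \<in> Obj C"
  show "omap (endo T) a \<in> Obj C" using P_Obj[OF a] by simp
  have "amap (endo T) (Id C a) = Id C (P a)"
  proof (rule coproduct_eqI[OF orbit_coproduct[OF a]])
    show "amap (endo T) (Id C a) \<in> Hom C (P a) (P a)" using endo_arr(1)[OF Id_Hom[OF a]] .
    show "Id C (P a) \<in> Hom C (P a) (P a)" using Id_Hom[OF P_Obj[OF a]] .
    fix g assume g: "g \<in> carrier G"
    show "amap (endo T) (Id C a) \<cdot>\<^bsub>C\<^esub> \<iota> a g = Id C (P a) \<cdot>\<^bsub>C\<^esub> \<iota> a g"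
      using endo_arr(2)[OF Id_Hom[OF a] g] Comp_Id[OF inj_Hom[OF a g]] Id_Comp[OF inj_Hom[OF a g]]
      by (simp add: act_Id[OF g a])
  qed
  then show "amap (endo T) (Id C a) = Id C (omap (endo T) a)" by simp
next
  fix f a b assume f: "f \<in> Hom C a b"
  show "amap (endo T) f \<in> Hom C (omap (endo T) a) (omap (endo T) b)"
    using endo_arr(1)[OF f] by simp
  fix k c assume k: "k \<in> Hom C b c"
  note kf = Comp_Hom[OF f k]
  have a: "a \<in> Obj C" and b: "b \<in> Obj C" and c: "c \<in> Obj C"
    using Hom_Obj f k by blast+
  show "amap (endo T) (k \<cdot>\<^bsub>C\<^esub> f) = amap (endo T) k \<cdot>\<^bsub>C\<^esub> amap (endo T) f"
  proof (rule coproduct_eqI[OF orbit_coproduct[OF a] endo_arr(1)[OF kf]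
        Comp_Hom[OF endo_arr(1)[OF f] endo_arr(1)[OF k]]])
    fix g assume g: "g \<in> carrier G"
    have "amap (endo T) k \<cdot>\<^bsub>C\<^esub> amap (endo T) f \<cdot>\<^bsub>C\<^esub> \<iota> a g
        = amap (endo T) k \<cdot>\<^bsub>C\<^esub> (\<iota> b g \<cdot>\<^bsub>C\<^esub> amap (act g) f)"
      using Comp_assoc[OF inj_Hom[OF a g] endo_arr(1)[OF f] endo_arr(1)[OF k]] endo_arr(2)[OF f g]
      by simp
    also have "\<dots> = \<iota> c g \<cdot>\<^bsub>C\<^esub> amap (act g) k \<cdot>\<^bsub>C\<^esub> amap (act g) f"
      using Comp_assoc[OF act_Hom[OF g f] inj_Hom[OF b g] endo_arr(1)[OF k]] endo_arr(2)[OF k g]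
      by simp
    also have "\<dots> = \<iota> c g \<cdot>\<^bsub>C\<^esub> amap (act g) (k \<cdot>\<^bsub>C\<^esub> f)"
      using Comp_assoc[OF act_Hom[OF g f] act_Hom[OF g k] inj_Hom[OF c g]] act_Comp[OF g f k]
      by simp
    finally show "amap (endo T) (k \<cdot>\<^bsub>C\<^esub> f) \<cdot>\<^bsub>C\<^esub> \<iota> a g
        = amap (endo T) k \<cdot>\<^bsub>C\<^esub> amap (endo T) f \<cdot>\<^bsub>C\<^esub> \<iota> a g"
      using endo_arr(2)[OF kf g] by simp
  qed
qed

lemma mult_inj:
  assumes "X \<in> Obj C" and "h \<in> carrier G" and "g \<in> carrier G"
  shows "mult T X \<cdot>\<^bsub>C\<^esub> \<iota> (P X) h \<cdot>\<^bsub>C\<^esub> amap (act h) (\<iota> X g) = \<iota> X (h \<otimes> g)"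
  using mult_arr(2)[OF assms]
    Comp_assoc[OF act_Hom[OF assms(2) inj_Hom[OF assms(1,3)]] inj_Hom[OF P_Obj[OF assms(1)] assms(2)]
      mult_arr(1)[OF assms(1)]]
  by simp

lemma endo_comp_inj:
  assumes f: "f \<in> Hom C a b" and g: "g \<in> carrier G" and k: "k \<in> Hom C (P b) c"
  shows "k \<cdot>\<^bsub>C\<^esub> amap (endo T) f \<cdot>\<^bsub>C\<^esub> \<iota> a g = k \<cdot>\<^bsub>C\<^esub> \<iota> b g \<cdot>\<^bsub>C\<^esub> amap (act g) f"
proof -
  have ab: "a \<in> Obj C" "b \<in> Obj C" using Hom_Obj[OF f] by auto
  show ?thesis
    using Comp_assoc[OF inj_Hom[OF ab(1) g] endo_arr(1)[OF f] k] endo_arr(2)[OF f g]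
      Comp_assoc[OF act_Hom[OF g f] inj_Hom[OF ab(2) g] k] by simp
qed

theorem G_monad_is_monad: "cat_monad C T"
proof (intro cat_monad.intro cat_monad_axioms.intro)
  show "category C" ..
  interpret T: cat_functor C C "endo T" by (rule endo_functor)
  have TT: "cat_functor C C (comp_fmap (endo T) (endo T))"
  proof
    fix a assume "a \<in> Obj C"
    then show "omap (comp_fmap (endo T) (endo T)) a \<in> Obj C"
      and "amap (comp_fmap (endo T) (endo T)) (Id C a) = Id C (omap (comp_fmap (endo T) (endo T)) a)"
      using T.omap_Obj T.amap_Id by (simp_all add: comp_fmap_def del: endo_obj)
  next
    fix f a b assume f: "f \<in> Hom C a b"
    show "amap (comp_fmap (endo T) (endo T)) f
        \<in> Hom C (omap (comp_fmap (endo T) (endo T)) a) (omap (comp_fmap (endo T) (endo T)) b)"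
      using T.amap_Hom[OF T.amap_Hom[OF f]] by (simp add: comp_fmap_def)
    fix k c assume k: "k \<in> Hom C b c"
    show "amap (comp_fmap (endo T) (endo T)) (k \<cdot>\<^bsub>C\<^esub> f)
        = amap (comp_fmap (endo T) (endo T)) k \<cdot>\<^bsub>C\<^esub> amap (comp_fmap (endo T) (endo T)) f"
      using T.amap_Comp[OF T.amap_Hom[OF f] T.amap_Hom[OF k]] T.amap_Comp[OF f k]
      by (simp add: comp_fmap_def)
  qed
  have "cat_functor C C id_fmap"
    by unfold_locales (auto simp: id_fmap_def)
  then show "nat_transf C C id_fmap (endo T) (unit T)"
  proof (intro nat_transf.intro nat_transf_axioms.intro endo_functor)
    fix a assume a: "a \<in> Obj C"
    show "unit T a \<in> Hom C (omap id_fmap a) (omap (endo T) a)"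
      using inj_Hom[OF a one_closed] a by (simp add: id_fmap_def)
  next
    fix f a b assume f: "f \<in> Hom C a b"
    show "unit T b \<cdot>\<^bsub>C\<^esub> amap id_fmap f = amap (endo T) f \<cdot>\<^bsub>C\<^esub> unit T a"
      using endo_arr(2)[OF f one_closed] f by (simp add: id_fmap_def)
  qed
  show "nat_transf C C (comp_fmap (endo T) (endo T)) (endo T) (mult T)"
  proof (intro nat_transf.intro nat_transf_axioms.intro endo_functor TT)
    fix a assume a: "a \<in> Obj C"
    show "mult T a \<in> Hom C (omap (comp_fmap (endo T) (endo T)) a) (omap (endo T) a)"
      using mult_arr(1)[OF a] by (simp add: comp_fmap_def)
  next
    fix f a b assume f: "f \<in> Hom C a b"
    have a: "a \<in> Obj C" and b: "b \<in> Obj C" using Hom_Obj[OF f] by auto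
    note Tf = endo_arr(1)[OF f] and TTf = endo_arr(1)[OF endo_arr(1)[OF f]]
    have "mult T b \<cdot>\<^bsub>C\<^esub> amap (endo T) (amap (endo T) f) = amap (endo T) f \<cdot>\<^bsub>C\<^esub> mult T a"
    proof (rule coproduct_eqI[OF double_coproduct[OF a]
          Comp_Hom[OF TTf mult_arr(1)[OF b]] Comp_Hom[OF mult_arr(1)[OF a] Tf]])
      fix p assume "p \<in> carrier G \<times> carrier G"
      then obtain h g where p: "p = (h, g)" and h: "h \<in> carrier G" and g: "g \<in> carrier G" by auto
      note hg = m_closed[OF h g]
      note ih = inj_Hom[OF P_Obj[OF a] h] and ig = act_Hom[OF h inj_Hom[OF a g]]
      note jh = inj_Hom[OF P_Obj[OF b] h] and jg = act_Hom[OF h inj_Hom[OF b g]]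
      note mb = mult_arr(1)[OF b]
      have "mult T b \<cdot>\<^bsub>C\<^esub> amap (endo T) (amap (endo T) f)
            \<cdot>\<^bsub>C\<^esub> (\<iota> (P a) h \<cdot>\<^bsub>C\<^esub> amap (act h) (\<iota> a g))
          = mult T b \<cdot>\<^bsub>C\<^esub> amap (endo T) (amap (endo T) f) \<cdot>\<^bsub>C\<^esub> \<iota> (P a) h
            \<cdot>\<^bsub>C\<^esub> amap (act h) (\<iota> a g)"
        using Comp_assoc[OF ig ih Comp_Hom[OF TTf mb]] by simp
      also have "\<dots> = mult T b \<cdot>\<^bsub>C\<^esub> \<iota> (P b) h \<cdot>\<^bsub>C\<^esub> amap (act h) (amap (endo T) f)
            \<cdot>\<^bsub>C\<^esub> amap (act h) (\<iota> a g)"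
        using endo_comp_inj[OF Tf h mb] by simp
      also have "\<dots> = mult T b \<cdot>\<^bsub>C\<^esub> \<iota> (P b) h \<cdot>\<^bsub>C\<^esub>
            amap (act h) (\<iota> b g \<cdot>\<^bsub>C\<^esub> amap (act g) f)"
        using Comp_assoc[OF ig act_Hom[OF h Tf] Comp_Hom[OF jh mb]]
          act_Comp[OF h inj_Hom[OF a g] Tf] endo_arr(2)[OF f g] by simp
      also have "\<dots> = mult T b \<cdot>\<^bsub>C\<^esub> \<iota> (P b) h \<cdot>\<^bsub>C\<^esub> amap (act h) (\<iota> b g)
            \<cdot>\<^bsub>C\<^esub> amap (act h) (amap (act g) f)"
        using Comp_assoc[OF act_Hom[OF h act_Hom[OF g f]] jg Comp_Hom[OF jh mb]]
          act_Comp[OF h act_Hom[OF g f] inj_Hom[OF b g]] by simp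
      also have "\<dots> = \<iota> b (h \<otimes> g) \<cdot>\<^bsub>C\<^esub> amap (act (h \<otimes> g)) f"
        using mult_inj[OF b h g] act_mult_arr[OF h g f] by simp
      also have "\<dots> = amap (endo T) f \<cdot>\<^bsub>C\<^esub> \<iota> a (h \<otimes> g)"
        using endo_arr(2)[OF f hg] by simp
      also have "\<dots> = amap (endo T) f \<cdot>\<^bsub>C\<^esub> mult T a
            \<cdot>\<^bsub>C\<^esub> (\<iota> (P a) h \<cdot>\<^bsub>C\<^esub> amap (act h) (\<iota> a g))"
        using Comp_assoc[OF Comp_Hom[OF ig ih] mult_arr(1)[OF a] Tf] mult_arr(2)[OF a h g] by simp
      finally show "mult T b \<cdot>\<^bsub>C\<^esub> amap (endo T) (amap (endo T) f)
            \<cdot>\<^bsub>C\<^esub> (case p of (h, g) \<Rightarrow> \<iota> (P a) h \<cdot>\<^bsub>C\<^esub> amap (act h) (\<iota> a g))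
          = amap (endo T) f \<cdot>\<^bsub>C\<^esub> mult T a
            \<cdot>\<^bsub>C\<^esub> (case p of (h, g) \<Rightarrow> \<iota> (P a) h \<cdot>\<^bsub>C\<^esub> amap (act h) (\<iota> a g))"
        using p by simp
    qed
    then show "mult T b \<cdot>\<^bsub>C\<^esub> amap (comp_fmap (endo T) (endo T)) f = amap (endo T) f \<cdot>\<^bsub>C\<^esub> mult T a"
      by (simp add: comp_fmap_def)
  qed
next
  fix a assume a: "a \<in> Obj C"
  note Pa = P_Obj[OF a] and m = mult_arr(1)[OF a]
  have iP: "\<iota> (P a) \<one> \<in> Hom C (P a) (P (P a))"
    using inj_Hom[OF Pa one_closed] Pa by simp
  have i1: "\<iota> a \<one> \<in> Hom C a (P a)"
    using inj_Hom[OF a one_closed] a by simp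
  have "mult T a \<cdot>\<^bsub>C\<^esub> \<iota> (P a) \<one> = Id C (P a)"
  proof (rule coproduct_eqI[OF orbit_coproduct[OF a] Comp_Hom[OF iP m] Id_Hom[OF Pa]])
    fix g assume g: "g \<in> carrier G"
    show "mult T a \<cdot>\<^bsub>C\<^esub> \<iota> (P a) \<one> \<cdot>\<^bsub>C\<^esub> \<iota> a g = Id C (P a) \<cdot>\<^bsub>C\<^esub> \<iota> a g"
      using mult_inj[OF a one_closed g] act_one_simps(2)[OF inj_Hom[OF a g]]
        Id_Comp[OF inj_Hom[OF a g]] g by simp
  qed
  then show "mult T a \<cdot>\<^bsub>C\<^esub> unit T (omap (endo T) a) = Id C (omap (endo T) a)" by simp
  have "mult T a \<cdot>\<^bsub>C\<^esub> amap (endo T) (\<iota> a \<one>) = Id C (P a)"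
  proof (rule coproduct_eqI[OF orbit_coproduct[OF a] Comp_Hom[OF endo_arr(1)[OF i1] m] Id_Hom[OF Pa]])
    fix g assume g: "g \<in> carrier G"
    show "mult T a \<cdot>\<^bsub>C\<^esub> amap (endo T) (\<iota> a \<one>) \<cdot>\<^bsub>C\<^esub> \<iota> a g = Id C (P a) \<cdot>\<^bsub>C\<^esub> \<iota> a g"
      using endo_comp_inj[OF i1 g m] mult_inj[OF a g one_closed]
        Id_Comp[OF inj_Hom[OF a g]] g by simp
  qed
  then show "mult T a \<cdot>\<^bsub>C\<^esub> amap (endo T) (unit T a) = Id C (omap (endo T) a)" by simp
  have mP: "mult T (P a) \<in> Hom C (P (P (P a))) (P (P a))" using mult_arr(1)[OF Pa] .
  have Tm: "amap (endo T) (mult T a) \<in> Hom C (P (P (P a))) (P (P a))" using endo_arr(1)[OF m] .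
  have "mult T a \<cdot>\<^bsub>C\<^esub> amap (endo T) (mult T a) = mult T a \<cdot>\<^bsub>C\<^esub> mult T (P a)"
  proof (rule coproduct_eqI[OF orbit_coproduct[OF P_Obj[OF Pa]] Comp_Hom[OF Tm m] Comp_Hom[OF mP m]])
    fix k assume k: "k \<in> carrier G"
    note ik = inj_Hom[OF P_Obj[OF Pa] k] and jk = inj_Hom[OF Pa k]
    show "mult T a \<cdot>\<^bsub>C\<^esub> amap (endo T) (mult T a) \<cdot>\<^bsub>C\<^esub> \<iota> (P (P a)) k
        = mult T a \<cdot>\<^bsub>C\<^esub> mult T (P a) \<cdot>\<^bsub>C\<^esub> \<iota> (P (P a)) k"
    proof (rule coproduct_eqI[OF act_preserves_coproduct[OF k double_coproduct[OF a]]
          Comp_Hom[OF ik Comp_Hom[OF Tm m]] Comp_Hom[OF ik Comp_Hom[OF mP m]]])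
      fix p assume "p \<in> carrier G \<times> carrier G"
      then obtain h g where p: "p = (h, g)" and h: "h \<in> carrier G" and g: "g \<in> carrier G" by auto
      note ih = inj_Hom[OF Pa h] and ig = act_Hom[OF h inj_Hom[OF a g]]
      note d = Comp_Hom[OF ig ih]
      have "mult T a \<cdot>\<^bsub>C\<^esub> amap (endo T) (mult T a) \<cdot>\<^bsub>C\<^esub> \<iota> (P (P a)) k
            \<cdot>\<^bsub>C\<^esub> amap (act k) (\<iota> (P a) h \<cdot>\<^bsub>C\<^esub> amap (act h) (\<iota> a g))
          = mult T a \<cdot>\<^bsub>C\<^esub> \<iota> (P a) k \<cdot>\<^bsub>C\<^esub> amap (act k) (mult T a)
            \<cdot>\<^bsub>C\<^esub> amap (act k) (\<iota> (P a) h \<cdot>\<^bsub>C\<^esub> amap (act h) (\<iota> a g))"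
        using endo_comp_inj[OF m k m] by simp
      also have "\<dots> = mult T a \<cdot>\<^bsub>C\<^esub> \<iota> (P a) k \<cdot>\<^bsub>C\<^esub> amap (act k) (\<iota> a (h \<otimes> g))"
        using Comp_assoc[OF act_Hom[OF k d] act_Hom[OF k m] Comp_Hom[OF jk m]]
          act_Comp[OF k d m] mult_arr(2)[OF a h g] by simp
      also have "\<dots> = \<iota> a (k \<otimes> h \<otimes> g)"
        using mult_inj[OF a k m_closed[OF h g]] m_assoc[OF k h g] by simp
      also have "\<dots> = mult T a \<cdot>\<^bsub>C\<^esub> \<iota> (P a) (k \<otimes> h) \<cdot>\<^bsub>C\<^esub> amap (act k) (amap (act h) (\<iota> a g))"
        using mult_inj[OF a m_closed[OF k h] g] act_mult_arr[OF k h inj_Hom[OF a g]] by simp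
      also have "\<dots> = mult T a \<cdot>\<^bsub>C\<^esub> (mult T (P a) \<cdot>\<^bsub>C\<^esub> \<iota> (P (P a)) k
            \<cdot>\<^bsub>C\<^esub> amap (act k) (\<iota> (P a) h)) \<cdot>\<^bsub>C\<^esub> amap (act k) (amap (act h) (\<iota> a g))"
        using mult_inj[OF Pa k h] by simp
      also have "\<dots> = mult T a \<cdot>\<^bsub>C\<^esub> mult T (P a) \<cdot>\<^bsub>C\<^esub> \<iota> (P (P a)) k
            \<cdot>\<^bsub>C\<^esub> amap (act k) (\<iota> (P a) h) \<cdot>\<^bsub>C\<^esub> amap (act k) (amap (act h) (\<iota> a g))"
        using Comp_assoc[OF act_Hom[OF k ih] Comp_Hom[OF ik mP] m] Comp_assoc[OF ik mP m] by simp
      also have "\<dots> = mult T a \<cdot>\<^bsub>C\<^esub> mult T (P a) \<cdot>\<^bsub>C\<^esub> \<iota> (P (P a)) k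
            \<cdot>\<^bsub>C\<^esub> amap (act k) (\<iota> (P a) h \<cdot>\<^bsub>C\<^esub> amap (act h) (\<iota> a g))"
        using Comp_assoc[OF act_Hom[OF k ig] act_Hom[OF k ih] Comp_Hom[OF ik Comp_Hom[OF mP m]]]
          act_Comp[OF k ig ih] by simp
      finally show "mult T a \<cdot>\<^bsub>C\<^esub> amap (endo T) (mult T a) \<cdot>\<^bsub>C\<^esub> \<iota> (P (P a)) k
            \<cdot>\<^bsub>C\<^esub> amap (act k) (case p of (h, g) \<Rightarrow> \<iota> (P a) h \<cdot>\<^bsub>C\<^esub> amap (act h) (\<iota> a g))
          = mult T a \<cdot>\<^bsub>C\<^esub> mult T (P a) \<cdot>\<^bsub>C\<^esub> \<iota> (P (P a)) k
            \<cdot>\<^bsub>C\<^esub> amap (act k) (case p of (h, g) \<Rightarrow> \<iota> (P a) h \<cdot>\<^bsub>C\<^esub> amap (act h) (\<iota> a g))"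
        using p by simp
    qed
  qed
  then show "mult T a \<cdot>\<^bsub>C\<^esub> amap (endo T) (mult T a) = mult T a \<cdot>\<^bsub>C\<^esub> mult T (omap (endo T) a)"
    by simp
qed

end

end

end

theory Submission
  imports Defs
begin

text \<open>By the universal property of the coproduct, arrows \<open>\<alpha> : G(X) \<rightarrow> X\<close> correspond to
  families \<open>\<xi>\<^sub>g = \<alpha> \<cdot> \<iota>\<^sub>g\<close>. The unit law of an algebra reads \<open>\<xi>\<^sub>1 = 1\<close>; restricting the
  associative law along the injections \<open>\<iota>\<^sub>h \<cdot> h(\<iota>\<^sub>g)\<close> of \<open>G(G(X))\<close> gives
  \<open>\<xi>\<^sub>h\<^sub>g = \<xi>\<^sub>h \<cdot> h(\<xi>\<^sub>g)\<close>, and restricting the condition on algebra morphisms along \<open>\<iota>\<^sub>g\<close>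
  gives the condition on morphisms of cocycles; nothing is lost because these injections are jointly epic.\<close>

section \<open>Categories of objects with structure\<close>

lemma structured_cat_simps [simp]:
  "Obj (structured_cat C S M) = S"
  "Dom (structured_cat C S M) (a, b, f) = a"
  "Cod (structured_cat C S M) (a, b, f) = b"
  "Id (structured_cat C S M) a = (a, a, Id C (fst a))"
  "Comp (structured_cat C S M) (b', c, g) (a, b, f) = (a, c, g \<cdot>\<^bsub>C\<^esub> f)"
  by (simp_all add: structured_cat_def)

lemma Arr_structured_cat:
  "x \<in> Arr (structured_cat C S M) \<longleftrightarrow>
    (\<exists>a b f. x = (a, b, f) \<and> a \<in> S \<and> b \<in> S \<and> f \<in> Hom C (fst a) (fst b) \<and> M a b f)"
  by (auto simp: structured_cat_def)

lemma Hom_structured_cat: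
  "x \<in> Hom (structured_cat C S M) a b \<longleftrightarrow>
    (\<exists>f. x = (a, b, f) \<and> a \<in> S \<and> b \<in> S \<and> f \<in> Hom C (fst a) (fst b) \<and> M a b f)"
  \<comment> \<open>Instantiating \<open>Hom_def\<close> leaves the \<open>Hom C\<close> on the
    right folded. Without \<open>split_paired_Ex\<close> the bound objects are not split into pairs
    and can be eliminated by \<open>x = (a, b, f)\<close>.\<close>
  by (auto simp: Hom_def[of "structured_cat C S M"] Arr_structured_cat simp del: split_paired_Ex)

text \<open>Arrows compose as in \<open>C\<close> and carry their source and target, so the category
  laws are inherited. What remains is that \<open>M\<close> contains identities and is closed under
  composition.\<close>

lemma (in category) category_structured_cat:
  assumes S: "\<And>a. a \<in> S \<Longrightarrow> fst a \<in> Obj C"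
    and Id: "\<And>a. a \<in> S \<Longrightarrow> M a a (Id C (fst a))"
    and Comp: "\<And>a b c f g. \<lbrakk>a \<in> S; b \<in> S; c \<in> S; f \<in> Hom C (fst a) (fst b);
      g \<in> Hom C (fst b) (fst c); M a b f; M b c g\<rbrakk> \<Longrightarrow> M a c (g \<cdot> f)"
  shows "category (structured_cat C S M)"
proof
  fix f a b c d g h
  let ?D = "structured_cat C S M"
  show "Dom ?D f \<in> Obj ?D" and "Cod ?D f \<in> Obj ?D" if "f \<in> Arr ?D"
    using that by (auto simp: Arr_structured_cat)
  show "Id ?D a \<in> Hom ?D a a" if "a \<in> Obj ?D"
    using that S Id Id_Hom by (auto simp: Hom_structured_cat)
  show "g \<cdot>\<^bsub>?D\<^esub> f \<in> Hom ?D a c" if "f \<in> Hom ?D a b" "g \<in> Hom ?D b c"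
    using that by (auto simp: Hom_structured_cat intro: Comp Comp_Hom)
  show "f \<cdot>\<^bsub>?D\<^esub> Id ?D a = f" and "Id ?D b \<cdot>\<^bsub>?D\<^esub> f = f" if "f \<in> Hom ?D a b"
    using that Comp_Id Id_Comp by (auto simp: Hom_structured_cat)
  show "(h \<cdot>\<^bsub>?D\<^esub> g) \<cdot>\<^bsub>?D\<^esub> f = h \<cdot>\<^bsub>?D\<^esub> (g \<cdot>\<^bsub>?D\<^esub> f)"
    if "f \<in> Hom ?D a b" "g \<in> Hom ?D b c" "h \<in> Hom ?D c d"
    using that by (auto simp: Hom_structured_cat intro: Comp_assoc)
qed

text \<open>Since the underlying morphism is kept, identities and composites are preserved
  automatically.\<close>

lemma cat_functor_structured_cat:
  assumes "category (structured_cat C S M)" and "category (structured_cat C S' M')"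
    and \<Phi>: "\<And>a. a \<in> S \<Longrightarrow> \<Phi> a \<in> S'" and fst: "\<And>a. a \<in> S \<Longrightarrow> fst (\<Phi> a) = fst a"
    and M: "\<And>a b f. \<lbrakk>a \<in> S; b \<in> S; f \<in> Hom C (fst a) (fst b); M a b f\<rbrakk> \<Longrightarrow> M' (\<Phi> a) (\<Phi> b) f"
  shows "cat_functor (structured_cat C S M) (structured_cat C S' M')
    \<lparr>omap = \<Phi>, amap = (\<lambda>(a, b, f). (\<Phi> a, \<Phi> b, f))\<rparr>"
  by (intro cat_functor.intro cat_functor_axioms.intro assms(1,2))
    (auto simp: Hom_structured_cat \<Phi> fst M)

text \<open>The condition on morphisms is phrased through \<Psi> because in the application \<Psi>
  has an explicit formula, while \<Phi> is only given by a universal property.\<close>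

lemma cat_isomorphism_structured_cat:
  assumes "category (structured_cat C S M)" and "category (structured_cat C S' M')"
    and \<Phi>: "\<And>a. a \<in> S \<Longrightarrow> \<Phi> a \<in> S'" "\<And>a. a \<in> S \<Longrightarrow> fst (\<Phi> a) = fst a"
    and \<Psi>: "\<And>a. a \<in> S' \<Longrightarrow> \<Psi> a \<in> S" "\<And>a. a \<in> S' \<Longrightarrow> fst (\<Psi> a) = fst a"
    and inverse: "\<And>a. a \<in> S \<Longrightarrow> \<Psi> (\<Phi> a) = a" "\<And>a. a \<in> S' \<Longrightarrow> \<Phi> (\<Psi> a) = a"
    and M: "\<And>a b f. \<lbrakk>a \<in> S'; b \<in> S'; f \<in> Hom C (fst a) (fst b)\<rbrakk>
      \<Longrightarrow> M (\<Psi> a) (\<Psi> b) f \<longleftrightarrow> M' a b f"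
  shows "cat_isomorphism (structured_cat C S M) (structured_cat C S' M')
    \<lparr>omap = \<Phi>, amap = (\<lambda>(a, b, f). (\<Phi> a, \<Phi> b, f))\<rparr>"
  unfolding cat_isomorphism_def
proof (intro conjI exI)
  \<comment> \<open>The version for \<Phi> is the hypothesis at \<Phi> a and \<Phi> b, where \<Psi>
    undoes \<Phi>.\<close>
  have "M' (\<Phi> a) (\<Phi> b) f" if "a \<in> S" "b \<in> S" "f \<in> Hom C (fst a) (fst b)" "M a b f" for a b f
    using that M[of "\<Phi> a" "\<Phi> b" f] by (simp add: \<Phi> inverse)
  then show "cat_functor (structured_cat C S M) (structured_cat C S' M')
      \<lparr>omap = \<Phi>, amap = (\<lambda>(a, b, f). (\<Phi> a, \<Phi> b, f))\<rparr>"
    by (intro cat_functor_structured_cat assms(1,2) \<Phi>)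
  show "cat_functor (structured_cat C S' M') (structured_cat C S M)
      \<lparr>omap = \<Psi>, amap = (\<lambda>(a, b, f). (\<Psi> a, \<Psi> b, f))\<rparr>"
    by (intro cat_functor_structured_cat assms(1,2) \<Psi>) (simp_all add: M)
qed (auto simp: eq_fmap_def comp_fmap_def id_fmap_def Arr_structured_cat inverse)

section \<open>Cocycles and algebras\<close>

text \<open>Closure under composition is the pasting of two commutative squares, using that
  \<open>endo T\<close> preserves composites.\<close>

lemma (in cat_monad) category_Eilenberg_Moore: "category (Eilenberg_Moore C T)"
  unfolding Eilenberg_Moore_def
proof (rule category_structured_cat; clarsimp simp: algebras_def)
  \<comment> \<open>Functoriality of \<open>endo T\<close> is part of the unit being a natural
    transformation with target \<open>endo T\<close>.\<close>
  interpret T: cat_functor C C "endo T"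
    using unit_nat by (simp add: nat_transf_def)
  fix X \<alpha> assume "X \<in> Obj C" "\<alpha> \<in> Hom C (omap (endo T) X) X"
  then show "Id C X \<cdot> \<alpha> = \<alpha> \<cdot> amap (endo T) (Id C X)"
    using T.amap_Id Comp_Id Id_Comp by simp
next
  interpret T: cat_functor C C "endo T"
    using unit_nat by (simp add: nat_transf_def)
  fix X \<alpha> X' \<alpha>' X'' \<alpha>'' f f'
  assume \<alpha>: "\<alpha> \<in> Hom C (omap (endo T) X) X" "\<alpha>' \<in> Hom C (omap (endo T) X') X'"
      "\<alpha>'' \<in> Hom C (omap (endo T) X'') X''"
    and f: "f \<in> Hom C X X'" "f' \<in> Hom C X' X''"
    and eq: "f \<cdot> \<alpha> = \<alpha>' \<cdot> amap (endo T) f" "f' \<cdot> \<alpha>' = \<alpha>'' \<cdot> amap (endo T) f'"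
  note Tf = f[THEN T.amap_Hom]
  have "f' \<cdot> f \<cdot> \<alpha> = f' \<cdot> \<alpha>' \<cdot> amap (endo T) f"
    using Comp_assoc[OF \<alpha>(1) f] Comp_assoc[OF Tf(1) \<alpha>(2) f(2)] eq(1) by simp
  also have "\<dots> = \<alpha>'' \<cdot> amap (endo T) (f' \<cdot> f)"
    using Comp_assoc[OF Tf \<alpha>(3)] T.amap_Comp[OF f] eq(2) by simp
  finally show "f' \<cdot> f \<cdot> \<alpha> = \<alpha>'' \<cdot> amap (endo T) (f' \<cdot> f)" .
qed

section \<open>The category of cocycles\<close>

context G_category
begin

lemma cocycles_Hom:
  "(X, \<xi>) \<in> cocycles G C act \<Longrightarrow> g \<in> carrier G \<Longrightarrow> \<xi> g \<in> Hom C (omap (act g) X) X"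
  by (auto simp: cocycles_def)

lemma cocycles_Obj: "(X, \<xi>) \<in> cocycles G C act \<Longrightarrow> X \<in> Obj C"
  by (simp add: cocycles_def)

text \<open>The same pasting of squares as for algebras, now separately for each g with
  \<open>act g\<close> in place of the monad's endofunctor.\<close>

lemma category_Z1: "category (Z1 G C act)"
  unfolding Z1_def
proof (rule category_structured_cat; clarsimp)
  show "X \<in> Obj C" if "(X, \<xi>) \<in> cocycles G C act" for X \<xi>
    using that by (rule cocycles_Obj)
next
  fix X \<xi> g assume "(X, \<xi>) \<in> cocycles G C act" "g \<in> carrier G"
  then show "Id C X \<cdot>\<^bsub>C\<^esub> \<xi> g = \<xi> g \<cdot>\<^bsub>C\<^esub> amap (act g) (Id C X)"
    using Id_Comp Comp_Id cocycles_Hom cocycles_Obj act_Id by metis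
next
  fix X \<xi> X' \<xi>' X'' \<xi>'' f f' g
  assume \<xi>: "(X, \<xi>) \<in> cocycles G C act" "(X', \<xi>') \<in> cocycles G C act"
      "(X'', \<xi>'') \<in> cocycles G C act"
    and f: "f \<in> Hom C X X'" "f' \<in> Hom C X' X''" and g: "g \<in> carrier G"
    and eq: "\<forall>g\<in>carrier G. f \<cdot>\<^bsub>C\<^esub> \<xi> g = \<xi>' g \<cdot>\<^bsub>C\<^esub> amap (act g) f"
      "\<forall>g\<in>carrier G. f' \<cdot>\<^bsub>C\<^esub> \<xi>' g = \<xi>'' g \<cdot>\<^bsub>C\<^esub> amap (act g) f'"
  note \<xi>g = \<xi>[THEN cocycles_Hom, OF g] and gf = f[THEN act_Hom[OF g]]
  have "f' \<cdot>\<^bsub>C\<^esub> f \<cdot>\<^bsub>C\<^esub> \<xi> g = f' \<cdot>\<^bsub>C\<^esub> \<xi>' g \<cdot>\<^bsub>C\<^esub> amap (act g) f"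
    using Comp_assoc[OF \<xi>g(1) f] Comp_assoc[OF gf(1) \<xi>g(2) f(2)] eq(1) g by simp
  also have "\<dots> = \<xi>'' g \<cdot>\<^bsub>C\<^esub> amap (act g) (f' \<cdot>\<^bsub>C\<^esub> f)"
    using Comp_assoc[OF gf \<xi>g(3)] act_Comp[OF g f] eq(2) g by simp
  finally show "f' \<cdot>\<^bsub>C\<^esub> f \<cdot>\<^bsub>C\<^esub> \<xi> g = \<xi>'' g \<cdot>\<^bsub>C\<^esub> amap (act g) (f' \<cdot>\<^bsub>C\<^esub> f)" .
qed

text \<open>This will be the inverse of \<open>cocycle_to_algebra\<close>. Restricting to
  \<open>carrier G\<close> makes the family extensional, so that the two maps are inverse as strict
  equalities.\<close>

definition algebra_to_cocycle :: "('o \<Rightarrow> 'g \<Rightarrow> 'm) \<Rightarrow> 'o \<times> 'm \<Rightarrow> 'o \<times> ('g \<Rightarrow> 'm)" where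
  "algebra_to_cocycle \<iota> = (\<lambda>(X, \<alpha>). (X, \<lambda>g\<in>carrier G. \<alpha> \<cdot>\<^bsub>C\<^esub> \<iota> X g))"

section \<open>Bijections on objects and morphisms for a fixed choice of coproducts\<close>

context
  fixes P \<iota>
  assumes orbit: "orbit_coproducts G C act P \<iota>"
begin

lemma algebra_mult_iff:
  assumes X: "X \<in> Obj C" and \<alpha>: "\<alpha> \<in> Hom C (P X) X"
  shows "\<alpha> \<cdot>\<^bsub>C\<^esub> mult (T P \<iota>) X = \<alpha> \<cdot>\<^bsub>C\<^esub> amap (endo (T P \<iota>)) \<alpha> \<longleftrightarrow>
    (\<forall>g\<in>carrier G. \<forall>h\<in>carrier G.
      \<alpha> \<cdot>\<^bsub>C\<^esub> \<iota> X (h \<otimes> g) = \<alpha> \<cdot>\<^bsub>C\<^esub> \<iota> X h \<cdot>\<^bsub>C\<^esub> amap (act h) (\<alpha> \<cdot>\<^bsub>C\<^esub> \<iota> X g))"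
    (is "?l = ?r \<longleftrightarrow> _")
proof -
  note m = mult_arr[OF orbit X] and T\<alpha> = endo_arr(1)[OF orbit \<alpha>]
  have l: "?l \<in> Hom C (P (P X)) X" and r: "?r \<in> Hom C (P (P X)) X"
    using Comp_Hom[OF m(1) \<alpha>] Comp_Hom[OF T\<alpha> \<alpha>] .
  let ?\<kappa> = "\<lambda>h g. \<iota> (P X) h \<cdot>\<^bsub>C\<^esub> amap (act h) (\<iota> X g)"
  have restrict: "?l \<cdot>\<^bsub>C\<^esub> ?\<kappa> h g = \<alpha> \<cdot>\<^bsub>C\<^esub> \<iota> X (h \<otimes> g)"
      "?r \<cdot>\<^bsub>C\<^esub> ?\<kappa> h g = \<alpha> \<cdot>\<^bsub>C\<^esub> \<iota> X h \<cdot>\<^bsub>C\<^esub> amap (act h) (\<alpha> \<cdot>\<^bsub>C\<^esub> \<iota> X g)"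
    if h: "h \<in> carrier G" and g: "g \<in> carrier G" for h g
  proof -
    note ih = inj_Hom[OF orbit P_Obj[OF orbit X] h] and ig = act_Hom[OF h inj_Hom[OF orbit X g]]
    note jh = Comp_Hom[OF inj_Hom[OF orbit X h] \<alpha>]
    show "?l \<cdot>\<^bsub>C\<^esub> ?\<kappa> h g = \<alpha> \<cdot>\<^bsub>C\<^esub> \<iota> X (h \<otimes> g)"
      using Comp_assoc[OF Comp_Hom[OF ig ih] m(1) \<alpha>] m(2)[OF h g] by simp
    \<comment> \<open>Moving the endofunctor's value at \<alpha> past the injection of index h turns
      it into \<open>act h\<close> applied to \<alpha>, which functoriality of \<open>act h\<close>
      then merges with the inner injection.\<close>
    have "?r \<cdot>\<^bsub>C\<^esub> ?\<kappa> h g = ?r \<cdot>\<^bsub>C\<^esub> \<iota> (P X) h \<cdot>\<^bsub>C\<^esub> amap (act h) (\<iota> X g)"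
      using Comp_assoc[OF ig ih r] by simp
    also have "\<dots> = \<alpha> \<cdot>\<^bsub>C\<^esub> \<iota> X h \<cdot>\<^bsub>C\<^esub> amap (act h) \<alpha> \<cdot>\<^bsub>C\<^esub> amap (act h) (\<iota> X g)"
      using endo_comp_inj[OF orbit \<alpha> h \<alpha>] by simp
    also have "\<dots> = \<alpha> \<cdot>\<^bsub>C\<^esub> \<iota> X h \<cdot>\<^bsub>C\<^esub> amap (act h) (\<alpha> \<cdot>\<^bsub>C\<^esub> \<iota> X g)"
      using Comp_assoc[OF ig act_Hom[OF h \<alpha>] jh] act_Comp[OF h inj_Hom[OF orbit X g] \<alpha>] by simp
    finally show "?r \<cdot>\<^bsub>C\<^esub> ?\<kappa> h g = \<alpha> \<cdot>\<^bsub>C\<^esub> \<iota> X h \<cdot>\<^bsub>C\<^esub> amap (act h) (\<alpha> \<cdot>\<^bsub>C\<^esub> \<iota> X g)" .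
  qed
  show ?thesis
  proof
    assume "?l = ?r"
    then show "\<forall>g\<in>carrier G. \<forall>h\<in>carrier G.
        \<alpha> \<cdot>\<^bsub>C\<^esub> \<iota> X (h \<otimes> g) = \<alpha> \<cdot>\<^bsub>C\<^esub> \<iota> X h \<cdot>\<^bsub>C\<^esub> amap (act h) (\<alpha> \<cdot>\<^bsub>C\<^esub> \<iota> X g)"
      using restrict by metis
  next
    assume "\<forall>g\<in>carrier G. \<forall>h\<in>carrier G.
        \<alpha> \<cdot>\<^bsub>C\<^esub> \<iota> X (h \<otimes> g) = \<alpha> \<cdot>\<^bsub>C\<^esub> \<iota> X h \<cdot>\<^bsub>C\<^esub> amap (act h) (\<alpha> \<cdot>\<^bsub>C\<^esub> \<iota> X g)"
    then show "?l = ?r"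
      by (intro coproduct_eqI[OF double_coproduct[OF orbit X] l r]) (auto simp: restrict)
  qed
qed

text \<open>An equivalence, because both directions serve: one makes
  \<open>algebra_to_cocycle\<close> well defined, the other makes \<open>cocycle_to_algebra\<close>
  well defined.\<close>

lemma algebra_to_cocycle_iff:
  assumes X: "X \<in> Obj C" and \<alpha>: "\<alpha> \<in> Hom C (P X) X"
  shows "algebra_to_cocycle \<iota> (X, \<alpha>) \<in> cocycles G C act \<longleftrightarrow> (X, \<alpha>) \<in> algebras C (T P \<iota>)"
proof -
  have "\<alpha> \<cdot>\<^bsub>C\<^esub> \<iota> X g \<in> Hom C (omap (act g) X) X" if "g \<in> carrier G" for g
    using Comp_Hom[OF inj_Hom[OF orbit X that] \<alpha>] .
  then show ?thesis
    using X \<alpha> algebra_mult_iff[OF X \<alpha>]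
    by (simp add: endo_obj[OF orbit] unit_eq[OF orbit] algebra_to_cocycle_def cocycles_def algebras_def)
qed

lemma algebras_Hom:
  "(X, \<alpha>) \<in> algebras C (T P \<iota>) \<Longrightarrow> X \<in> Obj C \<and> \<alpha> \<in> Hom C (P X) X"
  by (simp add: algebras_def endo_obj[OF orbit])

text \<open>Uniqueness in the universal property: \<alpha> and the arrow induced by its own
  restrictions agree on every injection.\<close>

lemma algebra_to_cocycle_to_algebra:
  assumes "(X, \<alpha>) \<in> algebras C (T P \<iota>)"
  shows "cocycle_to_algebra G C P \<iota> (algebra_to_cocycle \<iota> (X, \<alpha>)) = (X, \<alpha>)"
proof -
  have X: "X \<in> Obj C" and \<alpha>: "\<alpha> \<in> Hom C (P X) X" using algebras_Hom[OF assms] by auto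
  let ?\<xi> = "\<lambda>g\<in>carrier G. \<alpha> \<cdot>\<^bsub>C\<^esub> \<iota> X g"
  have \<xi>: "?\<xi> g \<in> Hom C (omap (act g) X) X" if "g \<in> carrier G" for g
    using Comp_Hom[OF inj_Hom[OF orbit X that] \<alpha>] that by simp
  note cop = orbit_coproduct[OF orbit X]
  have "copair C (carrier G) (P X) (\<iota> X) X ?\<xi> = \<alpha>"
  proof (rule coproduct_eqI[OF cop copair_Hom[OF cop X \<xi>] \<alpha>])
    show "copair C (carrier G) (P X) (\<iota> X) X ?\<xi> \<cdot>\<^bsub>C\<^esub> \<iota> X g = \<alpha> \<cdot>\<^bsub>C\<^esub> \<iota> X g"
      if "g \<in> carrier G" for g
      using that by (subst copair_inj[OF cop X \<xi> that]) simp_all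
  qed
  then show ?thesis by (simp add: cocycle_to_algebra_def algebra_to_cocycle_def)
qed

lemma cocycle_to_algebra_to_cocycle:
  assumes "(X, \<xi>) \<in> cocycles G C act"
  shows "algebra_to_cocycle \<iota> (cocycle_to_algebra G C P \<iota> (X, \<xi>)) = (X, \<xi>)"
proof -
  \<comment> \<open>On \<open>carrier G\<close> the induced arrow restricts to the given family;
    extensionality settles equality at all other indices.\<close>
  have "\<xi> \<in> extensional (carrier G)" using assms by (auto simp: cocycles_def PiE_def)
  then have "(\<lambda>g\<in>carrier G. copair C (carrier G) (P X) (\<iota> X) X \<xi> \<cdot>\<^bsub>C\<^esub> \<iota> X g) = \<xi>"
    using copair_inj[OF orbit_coproduct[OF orbit cocycles_Obj[OF assms]] cocycles_Obj[OF assms]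
        cocycles_Hom[OF assms]]
    by (intro extensionalityI[of _ "carrier G"]) auto
  then show ?thesis by (simp add: cocycle_to_algebra_def algebra_to_cocycle_def)
qed

text \<open>No new calculation with the algebra laws: the induced arrow restricts to the given
  cocycle, so \<open>algebra_to_cocycle_iff\<close> applies to it.\<close>

lemma cocycle_to_algebra_in_algebras:
  assumes "(X, \<xi>) \<in> cocycles G C act"
  shows "cocycle_to_algebra G C P \<iota> (X, \<xi>) \<in> algebras C (T P \<iota>)"
proof -
  note X = cocycles_Obj[OF assms]
  note copair = copair_Hom[OF orbit_coproduct[OF orbit X] X cocycles_Hom[OF assms]]
  show ?thesis
    using assms cocycle_to_algebra_to_cocycle[OF assms] algebra_to_cocycle_iff[OF X copair]
    by (simp add: cocycle_to_algebra_def)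
qed

text \<open>Both sides of the algebra condition are arrows out of the coproduct \<open>P X\<close>,
  so equality can be tested on its injections.\<close>

lemma algebra_morphism_iff:
  assumes X: "X \<in> Obj C" and X': "X' \<in> Obj C" and \<alpha>: "\<alpha> \<in> Hom C (P X) X"
    and \<alpha>': "\<alpha>' \<in> Hom C (P X') X'" and f: "f \<in> Hom C X X'"
  shows "(\<forall>g\<in>carrier G. f \<cdot>\<^bsub>C\<^esub> (\<alpha> \<cdot>\<^bsub>C\<^esub> \<iota> X g) = \<alpha>' \<cdot>\<^bsub>C\<^esub> \<iota> X' g \<cdot>\<^bsub>C\<^esub> amap (act g) f) \<longleftrightarrow>
    f \<cdot>\<^bsub>C\<^esub> \<alpha> = \<alpha>' \<cdot>\<^bsub>C\<^esub> amap (endo (T P \<iota>)) f"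
proof -
  have "f \<cdot>\<^bsub>C\<^esub> \<alpha> \<cdot>\<^bsub>C\<^esub> \<iota> X g = f \<cdot>\<^bsub>C\<^esub> (\<alpha> \<cdot>\<^bsub>C\<^esub> \<iota> X g)" if "g \<in> carrier G" for g
    using Comp_assoc[OF inj_Hom[OF orbit X that] \<alpha> f] .
  moreover have "\<alpha>' \<cdot>\<^bsub>C\<^esub> amap (endo (T P \<iota>)) f \<cdot>\<^bsub>C\<^esub> \<iota> X g
      = \<alpha>' \<cdot>\<^bsub>C\<^esub> \<iota> X' g \<cdot>\<^bsub>C\<^esub> amap (act g) f" if "g \<in> carrier G" for g
    using endo_comp_inj[OF orbit f that \<alpha>'] .
  ultimately show ?thesis
    using coproduct_eqI[OF orbit_coproduct[OF orbit X] Comp_Hom[OF \<alpha> f]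
        Comp_Hom[OF endo_arr(1)[OF orbit f] \<alpha>']]
    by metis
qed

theorem comparison_isomorphism:
  "cat_isomorphism (Z1 G C act) (Eilenberg_Moore C (T P \<iota>)) (comparison G C P \<iota>)"
  unfolding Z1_def Eilenberg_Moore_def comparison_def
proof (rule cat_isomorphism_structured_cat[where \<Psi> = "algebra_to_cocycle \<iota>"],
    \<comment> \<open>Folding restores the names of the two categories, so that the facts that they
      are categories match the first two goals.\<close>
    fold Z1_def Eilenberg_Moore_def)
  show "category (Z1 G C act)" by (rule category_Z1)
  show "category (Eilenberg_Moore C (T P \<iota>))"
    by (rule cat_monad.category_Eilenberg_Moore[OF G_monad_is_monad[OF orbit]])
next
  fix a assume "a \<in> cocycles G C act"
  then show "cocycle_to_algebra G C P \<iota> a \<in> algebras C (T P \<iota>)"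
    and "fst (cocycle_to_algebra G C P \<iota> a) = fst a"
    and "algebra_to_cocycle \<iota> (cocycle_to_algebra G C P \<iota> a) = a"
    by (cases a; simp add: cocycle_to_algebra_in_algebras cocycle_to_algebra_to_cocycle;
        simp add: cocycle_to_algebra_def)+
next
  fix a assume "a \<in> algebras C (T P \<iota>)"
  then show "algebra_to_cocycle \<iota> a \<in> cocycles G C act"
    and "fst (algebra_to_cocycle \<iota> a) = fst a"
    and "cocycle_to_algebra G C P \<iota> (algebra_to_cocycle \<iota> a) = a"
    using algebras_Hom
    by (cases a; simp add: algebra_to_cocycle_iff algebra_to_cocycle_to_algebra;
        simp add: algebra_to_cocycle_def)+
next
  fix a b f
  assume "a \<in> algebras C (T P \<iota>)" "b \<in> algebras C (T P \<iota>)" "f \<in> Hom C (fst a) (fst b)"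
  then show "(case algebra_to_cocycle \<iota> a of (X, \<xi>) \<Rightarrow> \<lambda>(X', \<xi>') f.
        \<forall>g\<in>carrier G. f \<cdot>\<^bsub>C\<^esub> \<xi> g = \<xi>' g \<cdot>\<^bsub>C\<^esub> amap (act g) f) (algebra_to_cocycle \<iota> b) f \<longleftrightarrow>
      (case a of (X, \<alpha>) \<Rightarrow> \<lambda>(X', \<alpha>') f.
        f \<cdot>\<^bsub>C\<^esub> \<alpha> = \<alpha>' \<cdot>\<^bsub>C\<^esub> amap (endo (T P \<iota>)) f) b f"
    using algebras_Hom algebra_morphism_iff
    by (cases a; cases b) (simp add: algebra_to_cocycle_def)
qed

end

end

theorem theorem2p5:
  fixes G :: "('g, 'z) monoid_scheme"
    and X :: "('o, 'm) cat"
    and act :: "'g \<Rightarrow> ('o, 'm, 'o, 'm) fmap"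
    and P :: "'o \<Rightarrow> 'o" and \<iota> :: "'o \<Rightarrow> 'g \<Rightarrow> 'm"
  assumes "group G"
    and "G_category G X act"
    and "has_coproducts X (carrier G)"
    and "orbit_coproducts G X act P \<iota>"
  shows "cat_isomorphism (Z1 G X act) (Eilenberg_Moore X (G_monad G X act P \<iota>))
           (comparison G X P \<iota>)"
  using assms(2,4) by (rule G_category.comparison_isomorphism)

end
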